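(* For every integer $n\ge 2$ the Euclidean space $\mathbb{R}^n$ contains a dense additive subgroup $G\subset\mathbb{R}^n$ such that (1) $G$ is a Bernstein set in $\mathbb{R}^n$; (2) $G$ (with the subspace topology) is locally connected; (3) $G$ has topological dimension $\dim(G)=n-1$; (4) $G$ is not a Borel subset of $\mathbb{R}^n$, and hence $G$ is not locally compact.
   Context: A subset $B$ of a Polish space $X$ is called a Bernstein set in $X$ if both $B$ and $X\setminus B$ meet every uncountable closed subset $F$ of $X$. Here $\dim$ denotes topological (covering) dimension; for separable metrizable spaces, such as subspaces of $\mathbb{R}^n$, it coincides with the small and large inductive dimensions. Subsets of $\mathbb{R}^n$ carry the subspace topology. *)

theory Defs
  imports "HOL-Analysis.Analysis"
begin

definition additive_subgroup_set :: "'a::group_add set \<Rightarrow> bool" where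
  "additive_subgroup_set G \<longleftrightarrow>
     0 \<in> G \<and> (\<forall>x\<in>G. \<forall>y\<in>G. x + y \<in> G) \<and> (\<forall>x\<in>G. - x \<in> G)"

definition bernstein_set :: "'a::polish_space set \<Rightarrow> bool" where
  "bernstein_set B \<longleftrightarrow>
     (\<forall>F. closed F \<and> uncountable F \<longrightarrow> F \<inter> B \<noteq> {} \<and> F \<inter> (UNIV - B) \<noteq> {})"

(* dim X \<le> k in the sense of Cech-Lebesgue: every finite open cover has a finite open
   refinement in which no point lies in more than k + 1 members.  For k = -1 this says
   that X is empty. *)
definition covering_dim_le :: "'a topology \<Rightarrow> int \<Rightarrow> bool" where
  "covering_dim_le X k \<longleftrightarrow> k \<ge> -1 \<and>
     (\<forall>\<U>. finite \<U> \<and> (\<forall>U\<in>\<U>. openin X U) \<and> \<Union>\<U> = topspace X \<longrightarrow>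
       (\<exists>\<V>. finite \<V> \<and> (\<forall>V\<in>\<V>. openin X V) \<and> \<Union>\<V> = topspace X \<and>
          (\<forall>V\<in>\<V>. \<exists>U\<in>\<U>. V \<subseteq> U) \<and>
          (\<forall>x\<in>topspace X. int (card {V \<in> \<V>. x \<in> V}) \<le> k + 1)))"

(* Takes the value -1 exactly on the empty space, and \<infinity> if no bound k exists. *)
definition covering_dim :: "'a topology \<Rightarrow> ereal" where
  "covering_dim X = Inf {ereal (of_int k) | k. covering_dim_le X k}"

end

theory Submission
  imports Defs
begin

text \<open>
  Every Bernstein set \<open>G\<close> in \<open>\<real>\<^sup>n\<close>, \<open>n \<ge> 2\<close>, is dense, locally connected and not Borel, and has covering
  dimension at least \<open>n - 1\<close>: a closed set that misses \<open>G\<close> is countable, and a countable set neither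
  separates a ball nor meets all of uncountably many parallel \<open>(n-1)\<close>-simplices.
  For the upper bound on the dimension choose disjoint dense sets \<open>A\<^sub>0, \<dots>, A\<^sub>n\<^sub>-\<^sub>1\<close> of reals, and let
  \<open>Z\<^sub>k\<close> consist of the points with no coordinate in \<open>A\<^sub>k\<close>. Each \<open>Z\<^sub>k\<close> is zero-dimensional, since boxes with
  end points in \<open>A\<^sub>k\<close> have their frontier outside \<open>Z\<^sub>k\<close>, and only the countable set \<open>D\<close> of points that have a
  coordinate in every \<open>A\<^sub>k\<close> is not covered by \<open>Z\<^sub>0, \<dots>, Z\<^sub>n\<^sub>-\<^sub>1\<close>. So it suffices that \<open>G\<close> avoids \<open>D\<close>.
  Such a \<open>G\<close> is a rational span: by transfinite recursion pick in every uncountable closed set two points,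
  each outside the rational span of \<open>D\<close> and of all points picked before, and let only the first of each pair
  generate \<open>G\<close>.
\<close>

section \<open>Bernstein sets in Euclidean space\<close>

text \<open>The condensation points of \<open>F\<close> form a nonempty perfect subset.\<close>

lemma lepoll_uncountable_closed:
  fixes F :: "'a::polish_space set"
  assumes "closed F" "uncountable F"
  shows "(UNIV::real set) \<lesssim> F"
proof -
  define P where "P = {x \<in> F. \<forall>T. open T \<and> x \<in> T \<longrightarrow> uncountable (F \<inter> T)}"
  obtain B :: "'a set set" where B: "countable B" "topological_basis B"
    using ex_countable_basis by blast
  \<comment> \<open>A point that is not a condensation point has a basic neighbourhood meeting
    \<open>F\<close> in a countable set, and there are only countably many basic sets.\<close>
  have "F - P \<subseteq> (\<Union>T \<in> {T\<in>B. countable (F \<inter> T)}. F \<inter> T)"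
  proof
    fix x assume "x \<in> F - P"
    then obtain T where T: "open T" "x \<in> T" "countable (F \<inter> T)" "x \<in> F"
      unfolding P_def by auto
    then obtain T' where "T' \<in> B" "x \<in> T'" "T' \<subseteq> T"
      using B(2) topological_basisE by metis
    moreover then have "countable (F \<inter> T')"
      using T(3) by (meson countable_subset inf_mono order_refl)
    ultimately show "x \<in> (\<Union>T \<in> {T\<in>B. countable (F \<inter> T)}. F \<inter> T)"
      using T by auto
  qed
  moreover have "countable (\<Union>T \<in> {T\<in>B. countable (F \<inter> T)}. F \<inter> T)"
    using B(1) by (intro countable_UN) auto
  ultimately have cnt: "countable (F - P)"
    by (rule countable_subset)
  have "P \<subseteq> F"
    by (auto simp: P_def)
  have "P \<noteq> {}"
    using cnt assms(2) by auto
  moreover have "euclidean derived_set_of P = P"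
  proof (intro set_eqI iffI)
    fix x assume x: "x \<in> euclidean derived_set_of P"
    then have ex: "\<exists>y. y \<noteq> x \<and> y \<in> P \<and> y \<in> T" if "open T" "x \<in> T" for T
      using that by (auto simp: in_derived_set_of)
    have "x \<in> F"
    proof (rule ccontr)
      assume "x \<notin> F"
      then show False
        using ex[of "- F"] assms(1) \<open>P \<subseteq> F\<close> by auto
    qed
    then show "x \<in> P"
      using ex unfolding P_def by blast
  next
    fix x assume x: "x \<in> P"
    have "\<exists>y. y \<noteq> x \<and> y \<in> P \<and> y \<in> T" if "open T" "x \<in> T" for T
    proof (rule ccontr)
      assume "\<not> ?thesis"
      \<comment> \<open>Around an isolated point \<open>x\<close> of \<open>P\<close>, every other
        nearby point of \<open>F\<close> lies in the countable set \<open>F - P\<close>.\<close>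
      then have "F \<inter> T \<subseteq> (F - P) \<union> {x}" by auto
      then have "countable (F \<inter> T)"
        using cnt by (meson countable_Un countable_empty countable_insert countable_subset)
      then show False
        using x that unfolding P_def by blast
    qed
    then show "x \<in> euclidean derived_set_of P"
      by (auto simp: in_derived_set_of)
  qed
  ultimately have "(UNIV::real set) \<lesssim> P"
    by (intro lepoll_perfect_set[of euclidean]) (auto simp: completely_metrizable_space_euclidean)
  then show ?thesis
    using \<open>P \<subseteq> F\<close> lepoll_trans subset_imp_lepoll by blast
qed

lemma bernstein_set_Compl: "bernstein_set (- G) \<longleftrightarrow> bernstein_set G"
  by (simp add: bernstein_set_def conj_commute flip: Compl_eq_Diff_UNIV)

lemma countable_closed_subset_bernstein:
  "bernstein_set G \<Longrightarrow> closed F \<Longrightarrow> F \<subseteq> G \<Longrightarrow> countable F"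
  unfolding bernstein_set_def by blast

lemma countable_closed_disjoint_bernstein:
  "bernstein_set G \<Longrightarrow> closed F \<Longrightarrow> F \<inter> G = {} \<Longrightarrow> countable F"
  unfolding bernstein_set_def by blast

section \<open>Density and local connectedness\<close>

lemma closure_bernstein:
  fixes G :: "'a::euclidean_space set"
  assumes "bernstein_set G"
  shows "closure G = UNIV"
proof -
  have "ball x e \<inter> G \<noteq> {}" if "e > 0" for x e
  proof -
    have "uncountable (cball x (e/2))"
      using that by (simp add: uncountable_cball)
    then have "cball x (e/2) \<inter> G \<noteq> {}"
      using assms closed_cball unfolding bernstein_set_def by blast
    moreover have "cball x (e/2) \<subseteq> ball x e"
      using that by auto
    ultimately show ?thesis by blast
  qed
  then show ?thesis
    by (auto simp: closure_approachable) (metis Int_emptyI dist_commute mem_ball)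
qed

text \<open>Two closed sets separating \<open>G\<close> within the ball overlap there in a set
  \<open>C\<close> that misses \<open>G\<close> and is therefore countable. By density they cover
  the ball, so their complements would separate the ball minus \<open>C\<close>, which is connected
  in dimension at least 2.\<close>

lemma connected_bernstein_Int_ball:
  fixes G :: "'a::euclidean_space set"
  assumes G: "bernstein_set G" and dim: "2 \<le> DIM('a)"
  shows "connected (G \<inter> ball a e)"
proof (rule ccontr)
  assume "\<not> connected (G \<inter> ball a e)"
  then obtain A B where AB: "closed A" "closed B" "G \<inter> ball a e \<subseteq> A \<union> B"
      "A \<inter> B \<inter> (G \<inter> ball a e) = {}" "A \<inter> (G \<inter> ball a e) \<noteq> {}" "B \<inter> (G \<inter> ball a e) \<noteq> {}"
    by (auto simp: connected_closed)
  define C where "C = ball a e \<inter> (A \<inter> B)"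
  have "C \<inter> G = {}"
    using AB(4) unfolding C_def by blast
  \<comment> \<open>\<open>C\<close> need not be closed, as the ball is open; exhausting the ball by
    closed balls splits \<open>C\<close> into countably many closed pieces.\<close>
  have "ball a e = (\<Union>m::nat. cball a (e - 1 / Suc m))"
  proof (intro set_eqI iffI)
    fix x assume "x \<in> ball a e"
    then have "0 < e - dist a x" by simp
    then obtain m :: nat where "inverse (of_nat (Suc m)) < e - dist a x"
      using reals_Archimedean by blast
    then have "x \<in> cball a (e - 1 / Suc m)"
      by (simp add: field_simps)
    then show "x \<in> (\<Union>m::nat. cball a (e - 1 / Suc m))" by blast
  next
    fix x assume "x \<in> (\<Union>m::nat. cball a (e - 1 / Suc m))"
    then obtain m :: nat where "dist a x \<le> e - 1 / Suc m" by auto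
    moreover have "1 / real (Suc m) > 0" by simp
    ultimately show "x \<in> ball a e" unfolding mem_ball by linarith
  qed
  then have CU: "C = (\<Union>m::nat. cball a (e - 1 / Suc m) \<inter> (A \<inter> B))"
    unfolding C_def by blast
  have "countable (cball a (e - 1 / Suc m) \<inter> (A \<inter> B))" for m :: nat
  proof (rule countable_closed_disjoint_bernstein[OF G])
    have "cball a (e - 1 / Suc m) \<inter> (A \<inter> B) \<subseteq> C"
      by (subst CU) blast
    with \<open>C \<inter> G = {}\<close>
    show "cball a (e - 1 / Suc m) \<inter> (A \<inter> B) \<inter> G = {}" by blast
  qed (use AB in auto)
  then have "countable C"
    unfolding CU by blast
  then have con: "connected (ball a e - C)"
    using dim by (intro connected_open_diff_countable) auto
  have "ball a e \<subseteq> closure (G \<inter> ball a e)"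
    using open_Int_closure_subset[of "ball a e" G] closure_bernstein[OF G]
    by (simp add: Int_commute)
  also have "\<dots> \<subseteq> A \<union> B"
    using AB by (intro closure_minimal) auto
  finally have cov: "(- A) \<inter> (- B) \<inter> (ball a e - C) = {}"
    by blast
  have "ball a e - C \<subseteq> (- A) \<union> (- B)"
    unfolding C_def by auto
  moreover have "(- A) \<inter> (ball a e - C) \<noteq> {}" "(- B) \<inter> (ball a e - C) \<noteq> {}"
    using AB(4-6) unfolding C_def by blast+
  ultimately show False
    using connectedD[OF con, of "- A" "- B"] cov AB(1,2) by (auto simp: open_Compl)
qed

lemma locally_connected_bernstein:
  fixes G :: "'a::euclidean_space set"
  assumes G: "bernstein_set G" and dim: "2 \<le> DIM('a)"
  shows "locally connected G"
  unfolding locally_connected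
proof (intro allI impI)
  fix v x assume "openin (top_of_set G) v \<and> x \<in> v"
  then obtain e where e: "e > 0" "ball x e \<inter> G \<subseteq> v" "x \<in> G"
    by (meson openin_contains_ball subsetD)
  then show "\<exists>u. openin (top_of_set G) u \<and> connected u \<and> x \<in> u \<and> u \<subseteq> v"
    by (intro exI[of _ "G \<inter> ball x e"])
      (auto simp: connected_bernstein_Int_ball[OF assms] openin_open_Int)
qed

section \<open>Borel sets, Lebesgue measure and local compactness\<close>

text \<open>Lebesgue measure is inner regular for closed sets, and closed subsets of a Bernstein set
  are countable, hence null.\<close>

lemma negligible_borel_bernstein:
  fixes G :: "'a::euclidean_space set"
  assumes G: "bernstein_set G" and "G \<in> sets borel"
  shows "negligible G"
proof -
  have leb: "G \<in> sets lebesgue"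
    using assms(2) by auto
  have "emeasure lebesgue G \<le> ennreal e" if e: "e > 0" for e
  proof -
    obtain T where T: "closed T" "T \<subseteq> G" "G - T \<in> lmeasurable" "emeasure lebesgue (G - T) < ennreal e"
      using sets_lebesgue_inner_closed[OF leb e] by metis
    have "T \<in> null_sets lebesgue"
      using countable_closed_subset_bernstein[OF G T(1,2)]
      by (simp add: countable_imp_null_set_lborel null_sets_completionI)
    then have "emeasure lebesgue (G - T) = emeasure lebesgue G"
      by (rule emeasure_Diff_null_set) (rule leb)
    with T(4) show ?thesis by simp
  qed
  then have "emeasure lebesgue G = 0"
    using ennreal_le_epsilon[of 0 "emeasure lebesgue G"] by simp
  with leb show ?thesis
    by (auto simp: negligible_iff_null_sets null_sets_def)
qed

lemma bernstein_not_borel: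
  fixes G :: "'a::euclidean_space set"
  assumes G: "bernstein_set G"
  shows "G \<notin> sets borel"
proof
  assume "G \<in> sets borel"
  then have "negligible G" "negligible (- G)"
    using assms negligible_borel_bernstein[of G] negligible_borel_bernstein[of "- G"]
    by (auto simp: bernstein_set_Compl borel_comp)
  then have "negligible (UNIV :: 'a set)"
    by (metis Compl_partition negligible_Un)
  then show False
    by (simp add: non_negligible_UNIV)
qed

text \<open>A locally compact subspace is open in its closure, so it is the intersection of an open
  and a closed set.\<close>

lemma locally_compact_imp_borel:
  fixes S :: "'a::euclidean_space set"
  assumes "locally compact S"
  shows "S \<in> sets borel"
proof -
  obtain T where "open T" "S = T \<inter> closure S"
    using locally_compact_open_Int_closure[OF assms] by metis
  then show ?thesis
    by (metis borel_closed borel_open closed_closure sets.Int)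
qed

section \<open>Lower bound for the dimension\<close>

text \<open>The size \<open>t\<close> stays free to provide uncountably many pairwise disjoint
  parallel simplices, one of which escapes a given countable set.\<close>

definition std_simplex :: "real \<Rightarrow> (real ^ 'n) set" where
  "std_simplex t = {x. (\<forall>i. 0 \<le> x $ i) \<and> (\<Sum>i\<in>UNIV. x $ i) = t}"

lemma compact_std_simplex: "compact (std_simplex t :: (real ^ 'n) set)"
proof -
  have "norm x \<le> t" if "x \<in> std_simplex t" for x :: "real ^ 'n"
    using norm_le_l1_cart[of x] that by (simp add: std_simplex_def)
  then have "bounded (std_simplex t :: (real ^ 'n) set)"
    by (auto simp: bounded_iff)
  moreover have "closed (std_simplex t :: (real ^ 'n) set)"
    unfolding std_simplex_def
    by (intro closed_Collect_conj closed_Collect_all closed_Collect_le closed_Collect_eq continuous_intros)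
  ultimately show ?thesis
    by (simp add: compact_eq_bounded_closed)
qed

lemma convex_std_simplex: "convex (std_simplex t :: (real ^ 'n) set)"
proof (rule convexI)
  fix x y :: "real ^ 'n" and u v :: real
  assume "x \<in> std_simplex t" "y \<in> std_simplex t" "0 \<le> u" "0 \<le> v" "u + v = 1"
  then show "u *\<^sub>R x + v *\<^sub>R y \<in> std_simplex t"
    by (auto simp: std_simplex_def sum.distrib simp flip: sum_distrib_left distrib_right)
qed

lemma axis_in_std_simplex: "0 \<le> t \<Longrightarrow> axis i t \<in> (std_simplex t :: (real ^ 'n) set)"
  by (simp add: std_simplex_def axis_def)

text \<open>
  Sort the members \<open>V\<close> of the cover by a face \<open>c V\<close> that they miss, and let \<open>\<psi> x i\<close> add up the distances of \<open>x\<close>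
  to the complements of those \<open>V\<close> with \<open>c V = i\<close>. If at every point some \<open>\<psi> x i\<close> vanished, then the normalised
  map \<open>h\<close> would be a self-map of the simplex. At its fixed point the coordinate \<open>i\<close> that maximises \<open>\<psi> x\<close> is \<open>0\<close>,
  although \<open>\<psi> x i > 0\<close> forces \<open>x\<close> off the \<open>i\<close>-th face.
\<close>

lemma Lebesgue_covering_simplex:
  fixes \<V> :: "(real ^ 'n) set set"
  assumes "finite \<V>" and opn: "\<And>V. V \<in> \<V> \<Longrightarrow> open V" and cov: "std_simplex t \<subseteq> \<Union>\<V>"
    and face: "\<And>V. V \<in> \<V> \<Longrightarrow> \<exists>i. \<forall>x \<in> V \<inter> std_simplex t. x $ i \<noteq> 0"
    and "0 < t" "2 \<le> CARD('n)"
  shows "\<exists>x \<in> std_simplex t. CARD('n) \<le> card {V \<in> \<V>. x \<in> V}"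
proof (rule ccontr)
  assume contra: "\<not> ?thesis"
  let ?S = "std_simplex t :: (real ^ 'n) set"
  obtain c where c: "\<And>V x. V \<in> \<V> \<Longrightarrow> x \<in> V \<Longrightarrow> x \<in> ?S \<Longrightarrow> x $ c V \<noteq> 0"
    using face by (metis IntI)
  \<comment> \<open>\<open>infdist\<close> to the empty set is 0, so the distance to
    \<open>- V\<close> detects membership in \<open>V\<close> only if \<open>V\<close> is not the
    whole space.\<close>
  have nuniv: "- V \<noteq> {}" if "V \<in> \<V>" for V
  proof
    assume "- V = {}"
    obtain j where "j \<noteq> c V"
      using assms(6) by (metis (full_types) One_nat_def UNIV_I UNIV_eq_I card.empty card.insert
          empty_iff finite.emptyI not_less_eq_eq numeral_2_eq_2 order_refl singletonI)
    then have "axis j t $ c V = 0"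
      by (simp add: axis_def)
    then show False
      using c[OF that, of "axis j t"] axis_in_std_simplex[of t j] \<open>- V = {}\<close> assms(5) by auto
  qed
  define d where "d x V = infdist x (- V)" for x and V :: "(real ^ 'n) set"
  have d_pos: "d x V > 0 \<longleftrightarrow> x \<in> V" if "V \<in> \<V>" for x V
  proof -
    have "x \<in> - V \<longleftrightarrow> d x V = 0"
      unfolding d_def using opn[OF that] nuniv[OF that] by (intro in_closed_iff_infdist_zero) auto
    then show ?thesis
      using infdist_nonneg[of x "- V"] unfolding d_def by auto
  qed
  define \<psi> where "\<psi> x i = (\<Sum>V | V \<in> \<V> \<and> c V = i. d x V)" for x i
  have \<psi>_pos: "\<psi> x i > 0 \<longleftrightarrow> (\<exists>V\<in>\<V>. c V = i \<and> x \<in> V)" for x i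
  proof
    assume "\<psi> x i > 0"
    then obtain V where "V \<in> \<V>" "c V = i" "d x V > 0"
      unfolding \<psi>_def by (metis (mono_tags, lifting) mem_Collect_eq not_le sum_nonpos)
    then show "\<exists>V\<in>\<V>. c V = i \<and> x \<in> V"
      using d_pos by blast
  next
    assume "\<exists>V\<in>\<V>. c V = i \<and> x \<in> V"
    then obtain V where "V \<in> \<V>" "c V = i" "x \<in> V" by blast
    then show "\<psi> x i > 0"
      unfolding \<psi>_def using d_pos assms(1)
      by (intro sum_pos2[of _ V]) (auto simp: d_def infdist_nonneg)
  qed
  have \<psi>_nn: "\<psi> x i \<ge> 0" for x i
    unfolding \<psi>_def d_def by (intro sum_nonneg infdist_nonneg)
  have cont_\<psi>: "continuous_on ?S (\<lambda>x. \<psi> x i)" for i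
    unfolding \<psi>_def d_def by (intro continuous_intros)
  have ex_pos: "\<exists>i. \<psi> x i > 0" if "x \<in> ?S" for x
    using that cov \<psi>_pos by blast
  \<comment> \<open>By assumption fewer than \<open>CARD('n)\<close> members contain
    \<open>x\<close>, so some value of \<open>c\<close> does not occur among them.\<close>
  have ex_zero: "\<exists>i. \<psi> x i = 0" if "x \<in> ?S" for x
  proof (rule ccontr)
    assume "\<not> ?thesis"
    then have "\<And>i. \<psi> x i > 0"
      using \<psi>_nn[of x] by (metis less_eq_real_def)
    then have "\<exists>V\<in>\<V>. c V = i \<and> x \<in> V" for i
      using \<psi>_pos by auto
    then have "i \<in> c ` {V \<in> \<V>. x \<in> V}" for i
      by (metis (mono_tags, lifting) image_eqI mem_Collect_eq)
    then have "UNIV \<subseteq> c ` {V \<in> \<V>. x \<in> V}"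
      by blast
    then have "CARD('n) \<le> card {V \<in> \<V>. x \<in> V}"
      using assms(1) by (intro surj_card_le) auto
    with contra that show False by blast
  qed
  \<comment> \<open>\<open>h x i\<close> vanishes exactly when \<open>\<psi> x i\<close> is maximal;
    \<open>H x\<close> is positive because \<open>\<psi> x\<close> takes both the value 0 and a
    positive value.\<close>
  define h where "h x i = (\<Sum>j\<in>UNIV. max 0 (\<psi> x j - \<psi> x i))" for x i
  define H where "H x = (\<Sum>i\<in>UNIV. h x i)" for x
  have h_nn: "h x i \<ge> 0" for x i
    unfolding h_def by (intro sum_nonneg) auto
  have H_pos: "H x > 0" if x: "x \<in> ?S" for x
  proof -
    obtain i j where "\<psi> x i = 0" "\<psi> x j > 0"
      using ex_zero[OF x] ex_pos[OF x] by blast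
    then have "h x i > 0"
      unfolding h_def by (intro sum_pos2[of _ j]) auto
    then show ?thesis
      unfolding H_def using h_nn by (intro sum_pos2[of _ i]) auto
  qed
  have cont_h: "continuous_on ?S (\<lambda>x. h x i)" for i
    unfolding h_def by (intro continuous_intros cont_\<psi>)
  define f :: "real ^ 'n \<Rightarrow> real ^ 'n" where "f x = (\<chi> i. t * (h x i / H x))" for x
  have "continuous_on ?S H"
    unfolding H_def by (intro continuous_intros cont_h)
  then have "continuous_on ?S f"
    unfolding f_def using H_pos
    by (intro continuous_on_vec_lambda continuous_intros cont_h) (auto simp: less_le)
  moreover have "f x \<in> ?S" if "x \<in> ?S" for x
  proof -
    have "(\<Sum>i\<in>UNIV. h x i / H x) = 1"
      using H_pos[OF that] by (simp add: H_def flip: sum_divide_distrib)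
    then have "(\<Sum>i\<in>UNIV. f x $ i) = t"
      by (simp only: f_def vec_lambda_beta mult_1_right flip: sum_distrib_left)
    moreover have "f x $ i \<ge> 0" for i
      using H_pos[OF that] h_nn[of x i] assms(5) by (simp add: f_def)
    ultimately show ?thesis
      by (simp add: std_simplex_def)
  qed
  moreover have "?S \<noteq> {}"
    using axis_in_std_simplex[of t] assms(5) by fastforce
  ultimately obtain x where x: "x \<in> ?S" "f x = x"
    using brouwer[OF compact_std_simplex convex_std_simplex] by (metis funcsetI)
  have "\<exists>i. \<forall>j. \<psi> x j \<le> \<psi> x i"
  proof -
    have "Max (range (\<psi> x)) \<in> range (\<psi> x)"
      by (intro Max_in) auto
    then obtain i where "\<psi> x i = Max (range (\<psi> x))"
      by force
    then have "\<forall>j. \<psi> x j \<le> \<psi> x i"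
      by simp
    then show ?thesis ..
  qed
  then obtain i where i: "\<And>j. \<psi> x j \<le> \<psi> x i" by blast
  then have "h x i = 0"
    unfolding h_def by (intro sum.neutral) (simp add: max_absorb1)
  then have "x $ i = 0"
    using x(2) by (metis (no_types) divide_eq_0_iff f_def mult_eq_0_iff vec_lambda_beta)
  moreover have "\<psi> x i > 0"
    using ex_pos[OF x(1)] i by (meson less_le_trans)
  then obtain V where V: "V \<in> \<V>" "c V = i" "x \<in> V"
    using \<psi>_pos by auto
  ultimately show False
    using c[OF V(1,3) x(1)] by simp
qed

text \<open>The test cover consists of the traces on \<open>G\<close> of a half-space below the
  simplices and of the half-spaces \<open>e < x $ i\<close>. A refinement extends to open sets of
  R^n that miss only countably many points, hence cover some simplex. There a point lies in
  \<open>CARD('n)\<close> of them, and density moves it into \<open>G\<close>.\<close>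

lemma covering_dim_le_bernstein:
  fixes G :: "(real ^ 'n) set"
  assumes G: "bernstein_set G" and n: "2 \<le> CARD('n)" and dim: "covering_dim_le (top_of_set G) k"
  shows "int CARD('n) - 1 \<le> k"
proof -
  \<comment> \<open>If no coordinate exceeds \<open>e\<close>, the coordinate sum is at most 1/2, so
    \<open>U0\<close> and the \<open>U i\<close> cover \<open>G\<close>.\<close>
  define e where "e = 1 / (2 * real CARD('n))"
  have e: "e > 0" "CARD('n) * e < 1"
    using n by (auto simp: e_def)
  define U where "U i = G \<inter> {x. e < x $ i}" for i
  define U0 where "U0 = G \<inter> {x. (\<Sum>i\<in>UNIV. x $ i) < 1}"
  define \<U> where "\<U> = insert U0 (range U)"
  \<comment> \<open>This carries inequalities from \<open>G\<close> to open sets of R^n; strict ones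
    become weak, which the strict bounds \<open>0 < e\<close> and \<open>1 < t\<close>
    absorb.\<close>
  have dense: "T \<subseteq> F" if "open T" "closed F" "T \<inter> G \<subseteq> F" for T F
    using open_Int_closure_subset[OF that(1), of G] closure_minimal[OF that(3,2)] closure_bernstein[OF G]
    by auto
  have "finite \<U>"
    by (simp add: \<U>_def)
  moreover have "\<forall>U\<in>\<U>. openin (top_of_set G) U"
    unfolding \<U>_def U_def U0_def
    by (auto intro!: openin_open_Int open_Collect_less continuous_intros)
  moreover have "\<Union>\<U> = G"
  proof -
    have "x \<in> \<Union>\<U>" if "x \<in> G" for x
    proof (rule ccontr)
      assume "x \<notin> \<Union>\<U>"
      then have "x $ i \<le> e" "(\<Sum>i\<in>UNIV. x $ i) \<ge> 1" for i
        using that by (auto simp: \<U>_def U_def U0_def not_less)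
      moreover from this have "(\<Sum>i\<in>UNIV. x $ i) \<le> CARD('n) * e"
        using sum_bounded_above[of UNIV "\<lambda>i. x $ i" e] by simp
      ultimately show False
        using e(2) by linarith
    qed
    then show ?thesis
      by (auto simp: \<U>_def U_def U0_def)
  qed
  ultimately have "\<exists>\<V>. finite \<V> \<and> (\<forall>V\<in>\<V>. openin (top_of_set G) V) \<and> \<Union>\<V> = G \<and>
      (\<forall>V\<in>\<V>. \<exists>U\<in>\<U>. V \<subseteq> U) \<and>
      (\<forall>x\<in>G. int (card {V \<in> \<V>. x \<in> V}) \<le> k + 1)"
    using dim unfolding covering_dim_le_def topspace_euclidean_subtopology by blast
  then obtain \<V> where fin: "finite \<V>" and opn: "\<forall>V\<in>\<V>. openin (top_of_set G) V" and cov: "\<Union>\<V> = G"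
      and ref: "\<forall>V\<in>\<V>. \<exists>U\<in>\<U>. V \<subseteq> U" and ord: "\<forall>x\<in>G. int (card {V \<in> \<V>. x \<in> V}) \<le> k + 1"
    by (elim exE conjE)
  note \<V> = fin bspec[OF opn] cov bspec[OF ref] bspec[OF ord]
  \<comment> \<open>\<open>E V\<close> is the largest open set with trace \<open>V\<close> on \<open>G\<close>; as \<open>G\<close> is dense, passing to it does not raise the
    order of the cover.\<close>
  define E where "E V = - closure (G - V)" for V
  have openE: "open (E V)" for V
    by (simp add: E_def open_Compl)
  have E_Int: "E V \<inter> G = V" if VV: "V \<in> \<V>" for V
  proof -
    obtain T where "open T" "V = G \<inter> T"
      using \<V>(2)[OF VV] by (auto simp: openin_open)
    then have "T \<inter> closure (G - V) = {}"
      by (auto simp: open_Int_closure_eq_empty)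
    with \<open>V = G \<inter> T\<close> show ?thesis
      using closure_subset[of "G - V"] by (auto simp: E_def)
  qed
  define C where "C = - (\<Union>V\<in>\<V>. E V)"
  have "countable C"
  proof (rule countable_closed_disjoint_bernstein[OF G])
    show "closed C"
      unfolding C_def using openE by (intro closed_Compl open_UN) auto
    show "C \<inter> G = {}"
      using \<V>(3) E_Int unfolding C_def by blast
  qed
  \<comment> \<open>The simplices lie in different level sets of the coordinate sum, so
    \<open>C\<close> meets only countably many of them.\<close>
  then have "countable ((\<lambda>x. \<Sum>i\<in>UNIV. x $ i) ` C)"
    by (rule countable_image)
  then have "\<not> {1<..<2} \<subseteq> (\<lambda>x. \<Sum>i\<in>UNIV. x $ i) ` C"
    using uncountable_open_interval[of 1 2] countable_subset by auto
  then obtain t :: real where "t \<in> {1<..<2}" and t2: "t \<notin> (\<lambda>x. \<Sum>i\<in>UNIV. x $ i) ` C"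
    by (meson subsetI)
  then have t1: "1 < t" by simp
  have "std_simplex t \<subseteq> - C"
  proof
    fix x :: "real ^ 'n" assume "x \<in> std_simplex t"
    then have "t = (\<Sum>i\<in>UNIV. x $ i)"
      by (simp add: std_simplex_def)
    then show "x \<in> - C"
      using t2 by blast
  qed
  then have "std_simplex t \<subseteq> \<Union>(E ` \<V>)"
    by (simp add: C_def)
  moreover have "\<exists>i. \<forall>x \<in> W \<inter> std_simplex t. x $ i \<noteq> 0" if W: "W \<in> E ` \<V>" for W
  proof -
    obtain V where V: "V \<in> \<V>" "W = E V"
      using W by blast
    then obtain X where X: "X \<in> \<U>" "V \<subseteq> X"
      using \<V>(4) by blast
    consider "X = U0" | i where "X = U i"
      using X(1) by (auto simp: \<U>_def)
    then show ?thesis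
    proof cases
      case 1
      have "E V \<subseteq> {x. (\<Sum>i\<in>UNIV. x $ i) \<le> 1}"
      proof (rule dense[OF openE])
        show "closed {x :: real ^ 'n. (\<Sum>i\<in>UNIV. x $ i) \<le> 1}"
          by (intro closed_Collect_le continuous_intros)
        show "E V \<inter> G \<subseteq> {x. (\<Sum>i\<in>UNIV. x $ i) \<le> 1}"
          unfolding E_Int[OF V(1)] using X(2) 1 by (auto simp: U0_def)
      qed
      then show ?thesis
        using t1 V(2) by (force simp: std_simplex_def)
    next
      case (2 i)
      have "E V \<subseteq> {x. e \<le> x $ i}"
      proof (rule dense[OF openE])
        show "closed {x :: real ^ 'n. e \<le> x $ i}"
          by (intro closed_Collect_le continuous_intros)
        show "E V \<inter> G \<subseteq> {x. e \<le> x $ i}"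
          unfolding E_Int[OF V(1)] using X(2) 2 by (auto simp: U_def)
      qed
      then show ?thesis
        using e(1) V(2) by (intro exI[of _ i]) force
    qed
  qed
  moreover have "finite (E ` \<V>)" "\<And>W. W \<in> E ` \<V> \<Longrightarrow> open W"
    using \<V>(1) openE by blast+
  ultimately have "\<exists>x \<in> std_simplex t. CARD('n) \<le> card {W \<in> E ` \<V>. x \<in> W}"
    using t1 n by (intro Lebesgue_covering_simplex) auto
  then obtain x where x: "CARD('n) \<le> card {W \<in> E ` \<V>. x \<in> W}"
    by blast
  \<comment> \<open>\<open>T\<close> is a neighbourhood of \<open>x\<close> whose points lie in
    every member that contains \<open>x\<close>; a point of \<open>G\<close> in it lies in at least
    as many members.\<close>
  define T where "T = \<Inter>{W \<in> E ` \<V>. x \<in> W}"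
  have "open T"
    unfolding T_def using \<V>(1) openE by (intro open_Inter) auto
  moreover have "x \<in> T"
    by (auto simp: T_def)
  ultimately have "T \<inter> G \<noteq> {}"
    using closure_bernstein[OF G] open_Int_closure_eq_empty[of T G] by auto
  then obtain y where y: "y \<in> T" "y \<in> G" by blast
  have "{W \<in> E ` \<V>. x \<in> W} \<subseteq> E ` {V \<in> \<V>. y \<in> V}"
  proof
    fix W assume "W \<in> {W \<in> E ` \<V>. x \<in> W}"
    then obtain V where V: "V \<in> \<V>" "W = E V" "x \<in> E V"
      by blast
    then have "y \<in> E V"
      using y(1) unfolding T_def by blast
    then have "y \<in> V"
      using E_Int[OF V(1)] y(2) by blast
    with V show "W \<in> E ` {V \<in> \<V>. y \<in> V}"
      by blast
  qed
  then have "card {W \<in> E ` \<V>. x \<in> W} \<le> card {V \<in> \<V>. y \<in> V}"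
    using \<V>(1) by (intro surj_card_le) auto
  with x \<V>(5)[OF y(2)] show ?thesis by linarith
qed

section \<open>Upper bound for the dimension\<close>

text \<open>Cover the part of \<open>Z\<close> in question by countably many sets whose frontiers
  miss \<open>Z\<close>, make them disjoint one after another, and unite those assigned to the same
  \<open>U\<close>.\<close>

lemma disjoint_open_refinement:
  fixes Z :: "'a::second_countable_topology set"
  assumes base: "\<And>x U. x \<in> Z \<Longrightarrow> open U \<Longrightarrow> x \<in> U \<Longrightarrow> \<exists>B. open B \<and> x \<in> B \<and> B \<subseteq> U \<and> frontier B \<inter> Z = {}"
    and opn: "\<And>U. U \<in> \<O> \<Longrightarrow> open U"
  shows "\<exists>W. (\<forall>U. open (W U) \<and> W U \<subseteq> U) \<and> disjoint_family_on W \<O> \<and> Z \<inter> \<Union>\<O> \<subseteq> (\<Union>U\<in>\<O>. W U)"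
proof -
  define \<B> where "\<B> = {B. open B \<and> frontier B \<inter> Z = {} \<and> (\<exists>U\<in>\<O>. B \<subseteq> U)}"
  have covB: "Z \<inter> \<Union>\<O> \<subseteq> \<Union>\<B>"
  proof
    fix x assume "x \<in> Z \<inter> \<Union>\<O>"
    then obtain U where U: "x \<in> Z" "U \<in> \<O>" "x \<in> U" by blast
    then obtain B where "open B" "x \<in> B" "B \<subseteq> U" "frontier B \<inter> Z = {}"
      using base opn by metis
    with U show "x \<in> \<Union>\<B>"
      unfolding \<B>_def by blast
  qed
  have "\<And>B. B \<in> \<B> \<Longrightarrow> open B"
    by (simp add: \<B>_def)
  then obtain \<C> where \<C>: "\<C> \<subseteq> \<B>" "countable \<C>" "\<Union>\<C> = \<Union>\<B>"
    using Lindelof by metis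
  show ?thesis
  proof (cases "\<C> = {}")
    case True
    then have "Z \<inter> \<Union>\<O> = {}"
      using covB \<C>(3) by blast
    then show ?thesis
      by (intro exI[of _ "\<lambda>_. {}"]) (auto simp: disjoint_family_on_def)
  next
    case False
    define b where "b = from_nat_into \<C>"
    have rb: "range b = \<C>"
      unfolding b_def using range_from_nat_into[OF False \<C>(2)] .
    then have b: "open (b m)" "frontier (b m) \<inter> Z = {}" "\<exists>U\<in>\<O>. b m \<subseteq> U" for m
      using \<C>(1) unfolding \<B>_def by blast+
    obtain c where c: "\<And>m. c m \<in> \<O>" "\<And>m. b m \<subseteq> c m"
      using b(3) by metis
    \<comment> \<open>Subtracting a closure keeps \<open>D m\<close> open. As the union is finite
      and the frontiers miss \<open>Z\<close>, it costs no more points of \<open>Z\<close> than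
      subtracting the sets \<open>b l\<close> themselves.\<close>
    define D where "D m = b m - closure (\<Union>l<m. b l)" for m
    define W where "W U = (\<Union>m\<in>{m. c m = U}. D m)" for U
    have "open (W U)" for U
      unfolding W_def D_def using b(1) by (intro open_UN ballI open_Diff) auto
    moreover have "W U \<subseteq> U" for U
      unfolding W_def D_def using c(2) by blast
    moreover have "disjoint_family_on W \<O>"
    proof -
      have lt: "D l \<inter> D m = {}" if "l < m" for l m
      proof -
        have "D l \<subseteq> (\<Union>l<m. b l)"
          using that unfolding D_def by blast
        also have "\<dots> \<subseteq> closure (\<Union>l<m. b l)"
          by (rule closure_subset)
        finally show ?thesis
          unfolding D_def by blast
      qed
      have eq: "l = m" if "x \<in> D l" "x \<in> D m" for x l m
        using lt[of l m] lt[of m l] that by (cases l m rule: linorder_cases) auto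
      have "U = V" if "x \<in> W U" "x \<in> W V" for x U V
      proof -
        obtain l m where "c l = U" "x \<in> D l" "c m = V" "x \<in> D m"
          using \<open>x \<in> W U\<close> \<open>x \<in> W V\<close> unfolding W_def by auto
        then show ?thesis
          using eq by metis
      qed
      then show ?thesis
        unfolding disjoint_family_on_def by (meson disjoint_iff)
    qed
    moreover have "Z \<inter> \<Union>\<O> \<subseteq> (\<Union>U\<in>\<O>. W U)"
    proof
      fix x assume x: "x \<in> Z \<inter> \<Union>\<O>"
      then have "x \<in> \<Union>(range b)"
        unfolding rb \<C>(3) using covB by (rule subsetD[rotated])
      then have ex: "\<exists>m. x \<in> b m"
        by simp
      define m where "m = (LEAST m. x \<in> b m)"
      have m: "x \<in> b m" "\<And>l. l < m \<Longrightarrow> x \<notin> b l"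
        unfolding m_def using LeastI_ex[OF ex] not_less_Least by auto
      have "x \<notin> closure (b l)" if "l < m" for l
        using m(2)[OF that] b(1,2)[of l] x by (auto simp: frontier_def interior_open)
      moreover have "closure (\<Union>l<m. b l) \<subseteq> (\<Union>l<m. closure (b l))"
        by (intro closure_minimal UN_mono closed_UN) (auto simp: closure_subset)
      ultimately have "x \<notin> closure (\<Union>l<m. b l)"
        by blast
      with m(1) have "x \<in> D m"
        by (simp add: D_def)
      then show "x \<in> (\<Union>U\<in>\<O>. W U)"
        using c(1)[of m] unfolding W_def by blast
    qed
    ultimately show ?thesis by blast
  qed
qed

text \<open>With all end points in \<open>A\<close>, a point of the closed box that has no
  coordinate in \<open>A\<close> lies in the open box.\<close>

lemma box_neighbourhood_avoiding:
  fixes x :: "real ^ 'n" and A :: "real set"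
  assumes dense: "\<And>a b. a < b \<Longrightarrow> \<exists>c\<in>A. a < c \<and> c < b"
    and x: "\<And>i. x $ i \<notin> A" and U: "open U" "x \<in> U"
  shows "\<exists>B. open B \<and> x \<in> B \<and> B \<subseteq> U \<and> frontier B \<inter> {x. \<forall>i. x $ i \<notin> A} = {}"
proof -
  obtain a b where ab: "x \<in> box a b" "box a b \<subseteq> U"
    using open_contains_box[OF U] by metis
  have "\<exists>c. c \<in> A \<and> a $ i < c \<and> c < x $ i" "\<exists>c. c \<in> A \<and> x $ i < c \<and> c < b $ i" for i
    using ab(1) dense by (metis mem_box_cart(1))+
  then obtain l u where l: "\<And>i. l i \<in> A \<and> a $ i < l i \<and> l i < x $ i"
    and u: "\<And>i. u i \<in> A \<and> x $ i < u i \<and> u i < b $ i"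
    by metis
  define B where "B = box (\<chi> i. l i) (\<chi> i. u i)"
  have "x \<in> B"
    using l u by (simp add: B_def mem_box_cart)
  moreover have "B \<subseteq> box a b"
  proof
    fix y assume "y \<in> B"
    then have "l i < y $ i \<and> y $ i < u i" for i
      by (simp add: B_def mem_box_cart)
    then show "y \<in> box a b"
      unfolding mem_box_cart using l u by (meson less_trans)
  qed
  moreover have "frontier B \<inter> {x. \<forall>i. x $ i \<notin> A} = {}"
  proof -
    have "y \<in> B" if y: "y \<in> closure B" "\<And>i. y $ i \<notin> A" for y
    proof -
      have "closure B \<subseteq> cbox (\<chi> i. l i) (\<chi> i. u i)"
        unfolding B_def by (intro closure_minimal box_subset_cbox closed_cbox)
      then have "l i \<le> y $ i \<and> y $ i \<le> u i" for i
        using y(1) by (auto simp: mem_box_cart)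
      moreover have "l i \<noteq> y $ i" "u i \<noteq> y $ i" for i
        using y(2) l u by metis+
      ultimately show "y \<in> B"
        unfolding B_def mem_box_cart by (metis less_le vec_lambda_beta)
    qed
    moreover have "interior B = B"
      unfolding B_def by (rule interior_open[OF open_box])
    ultimately show ?thesis
      unfolding frontier_def by blast
  qed
  ultimately show ?thesis
    using ab(2) by (intro exI[of _ B]) (auto simp: B_def)
qed

text \<open>The points avoiding \<open>A k\<close> yield one disjoint family for each
  \<open>k < N\<close>. Each point lies in at most one member per family, so in at most
  \<open>N\<close> members altogether.\<close>

lemma covering_dim_le_avoiding_grids:
  fixes G :: "(real ^ 'n) set" and A :: "nat \<Rightarrow> real set"
  assumes dense: "\<And>k a b. a < b \<Longrightarrow> \<exists>c\<in>A k. a < c \<and> c < b"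
    and avoid: "\<And>x. x \<in> G \<Longrightarrow> \<exists>k<N. \<forall>i. x $ i \<notin> A k"
  shows "covering_dim_le (top_of_set G) (int N - 1)"
  unfolding covering_dim_le_def topspace_euclidean_subtopology
proof (intro conjI allI impI)
  fix \<U> assume "finite \<U> \<and> (\<forall>U\<in>\<U>. openin (top_of_set G) U) \<and> \<Union>\<U> = G"
  then have fin: "finite \<U>" and opn: "\<And>U. U \<in> \<U> \<Longrightarrow> openin (top_of_set G) U" and cov: "\<Union>\<U> = G"
    by blast+
  have "\<exists>T. open T \<and> U = G \<inter> T" if "U \<in> \<U>" for U
    using opn[OF that] by (simp add: openin_open)
  then obtain E where E: "\<And>U. U \<in> \<U> \<Longrightarrow> open (E U)" "\<And>U. U \<in> \<U> \<Longrightarrow> U = G \<inter> E U"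
    by metis
  have "\<exists>W. (\<forall>U. open (W U) \<and> W U \<subseteq> U) \<and> disjoint_family_on W (E ` \<U>) \<and>
      {x. \<forall>i. x $ i \<notin> A k} \<inter> \<Union>(E ` \<U>) \<subseteq> (\<Union>U\<in>E ` \<U>. W U)" for k
  proof (rule disjoint_open_refinement)
    show "\<exists>B. open B \<and> x \<in> B \<and> B \<subseteq> U \<and> frontier B \<inter> {x. \<forall>i. x $ i \<notin> A k} = {}"
      if "x \<in> {x. \<forall>i. x $ i \<notin> A k}" "open U" "x \<in> U" for x U
      using that dense by (intro box_neighbourhood_avoiding) auto
  qed (use E in blast)
  then obtain W where W: "\<And>k U. open (W k U)" "\<And>k U. W k U \<subseteq> U"
      "\<And>k. disjoint_family_on (W k) (E ` \<U>)"
      "\<And>k. {x. \<forall>i. x $ i \<notin> A k} \<inter> \<Union>(E ` \<U>) \<subseteq> (\<Union>U\<in>E ` \<U>. W k U)"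
    by metis
  define \<V> where "\<V> = (\<lambda>(k, U). G \<inter> W k U) ` ({..<N} \<times> E ` \<U>)"
  show "\<exists>\<V>. finite \<V> \<and> (\<forall>V\<in>\<V>. openin (top_of_set G) V) \<and> \<Union>\<V> = G \<and>
      (\<forall>V\<in>\<V>. \<exists>U\<in>\<U>. V \<subseteq> U) \<and> (\<forall>x\<in>G. int (card {V \<in> \<V>. x \<in> V}) \<le> int N - 1 + 1)"
  proof (intro exI[of _ \<V>] conjI ballI)
    show "finite \<V>"
      unfolding \<V>_def using fin by blast
    show "openin (top_of_set G) V" if "V \<in> \<V>" for V
      using that W(1) unfolding \<V>_def by (auto intro: openin_open_Int)
    show "\<Union>\<V> = G"
    proof
      show "\<Union>\<V> \<subseteq> G"
        unfolding \<V>_def by auto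
      show "G \<subseteq> \<Union>\<V>"
      proof
        fix x assume x: "x \<in> G"
        then obtain k where k: "k < N" "\<forall>i. x $ i \<notin> A k"
          using avoid by blast
        have "x \<in> \<Union>(E ` \<U>)"
          using x cov E(2) by blast
        then obtain T where "T \<in> E ` \<U>" "x \<in> W k T"
          using W(4)[of k] k(2) by blast
        with x k(1) show "x \<in> \<Union>\<V>"
          unfolding \<V>_def by (intro UnionI[of "G \<inter> W k T"]) auto
      qed
    qed
    show "\<exists>U\<in>\<U>. V \<subseteq> U" if "V \<in> \<V>" for V
    proof -
      obtain k U where "U \<in> \<U>" "V = G \<inter> W k (E U)"
        using \<open>V \<in> \<V>\<close> unfolding \<V>_def by auto
      then show ?thesis
        using E(2)[of U] W(2)[of k "E U"] by blast
    qed
    show "int (card {V \<in> \<V>. x \<in> V}) \<le> int N - 1 + 1" if "x \<in> G" for x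
    proof -
      \<comment> \<open>Only the member indexed by \<open>T k\<close> in the \<open>k\<close>-th
        family can contain \<open>x\<close>; if none does, the arbitrary value is harmless for an
        upper bound on the count.\<close>
      define T where "T k = (SOME T. T \<in> E ` \<U> \<and> x \<in> W k T)" for k
      have T: "T' = T k" if "T' \<in> E ` \<U>" "x \<in> W k T'" for k T'
      proof -
        have "T k \<in> E ` \<U> \<and> x \<in> W k (T k)"
          unfolding T_def by (rule someI[of _ T']) (use that in blast)
        then show ?thesis
          using that W(3)[of k] unfolding disjoint_family_on_def by blast
      qed
      have "{V \<in> \<V>. x \<in> V} \<subseteq> (\<lambda>k. G \<inter> W k (T k)) ` {..<N}"
      proof
        fix V assume "V \<in> {V \<in> \<V>. x \<in> V}"
        then obtain k T' where "k < N" "T' \<in> E ` \<U>" "x \<in> W k T'" "V = G \<inter> W k T'"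
          unfolding \<V>_def by auto
        then show "V \<in> (\<lambda>k. G \<inter> W k (T k)) ` {..<N}"
          using T[of T' k] by (intro image_eqI[of _ _ k]) auto
      qed
      then have "card {V \<in> \<V>. x \<in> V} \<le> card {..<N}"
        by (intro surj_card_le) auto
      then show ?thesis by simp
    qed
  qed
qed auto

section \<open>Transfinite choice of independent points\<close>

unbundle cardinal_syntax

section \<open>Cardinality of spans over a countable field\<close>

lemma countable_ordLeq_infinite:
  assumes "countable A" "infinite B"
  shows "|A| \<le>o |B|"
proof -
  have "|A| \<le>o |UNIV :: nat set|"
    using assms(1) card_of_ordLeq[of A "UNIV :: nat set"] by (auto simp: countable_def)
  moreover have "|UNIV :: nat set| \<le>o |B|"
    using assms(2) infinite_iff_card_of_nat by blast
  ultimately show ?thesis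
    by (rule ordLeq_transitive)
qed

lemma countable_ordLess_uncountable:
  assumes "countable A" "uncountable C"
  shows "|A| <o |C|"
proof (rule ccontr)
  assume "\<not> |A| <o |C|"
  then have "|C| \<le>o |A|"
    using not_ordLess_iff_ordLeq[OF card_of_Well_order card_of_Well_order] by blast
  then obtain f where "inj_on f C" "f ` C \<subseteq> A"
    using card_of_ordLeq[of C A] by auto
  then have "countable C"
    using assms(1) by (meson countable_image_inj_on countable_subset)
  with assms(2) show False by simp
qed

context vector_space
begin

text \<open>The span is the union of the sets \<open>T n\<close> of combinations of \<open>n\<close>
  vectors from \<open>S\<close>, repetitions allowed; with countably many scalars each stage keeps
  the bound by the infinite \<open>B\<close>.\<close>

lemma card_of_span_ordLeq:
  assumes "countable (UNIV :: 'a set)" "infinite B" "|S| \<le>o |B|"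
  shows "|span S| \<le>o |B|"
proof -
  define T where "T n = ((\<lambda>X. (\<lambda>(c, s, t). c *s s + t) ` (UNIV \<times> S \<times> X)) ^^ n) {0}" for n
  have T0: "T 0 = {0}" and T_Suc: "T (Suc n) = (\<lambda>(c, s, t). c *s s + t) ` (UNIV \<times> S \<times> T n)" for n
    by (simp_all add: T_def)
  have T_le: "|T n| \<le>o |B|" for n
  proof (induction n)
    case 0
    show ?case unfolding T0 using assms(2) by (intro countable_ordLeq_infinite) simp_all
  next
    case (Suc n)
    have "|S \<times> T n| \<le>o |B|"
      by (intro card_of_Sigma_ordLeq_infinite[OF assms(2,3)] ballI Suc)
    then have "|(UNIV :: 'a set) \<times> S \<times> T n| \<le>o |B|"
      by (intro card_of_Sigma_ordLeq_infinite[OF assms(2) countable_ordLeq_infinite[OF assms(1,2)]] ballI)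
    then show ?case
      unfolding T_Suc using card_of_image ordLeq_transitive by blast
  qed
  have "span S \<subseteq> (\<Union>n. T n)"
  proof
    fix x assume "x \<in> span S"
    then show "x \<in> (\<Union>n. T n)"
    proof (induction rule: span_induct_alt)
      case base
      show ?case using T0 by blast
    next
      case (step c x y)
      then obtain n where "y \<in> T n" by blast
      then have "c *s x + y \<in> T (Suc n)"
        unfolding T_Suc using step(1) by (intro image_eqI[of _ _ "(c, x, y)"]) auto
      then show ?case by blast
    qed
  qed
  moreover have "|\<Union>n. T n| \<le>o |B|"
    by (rule card_of_UNION_ordLeq_infinite[OF assms(2) countable_ordLeq_infinite[OF _ assms(2)]])
      (simp_all add: T_le)
  ultimately show ?thesis
    using card_of_mono1 ordLeq_transitive by blast
qed

lemma card_of_span_ordLess: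
  assumes "countable (UNIV :: 'a set)" "uncountable C" "|S| <o |C|"
  shows "|span S| <o |C|"
proof -
  have inf: "infinite C"
    using assms(2) countable_finite by blast
  \<comment> \<open>A copy of the naturals makes the bound infinite even for finite
    \<open>S\<close>, yet keeps it below the uncountable \<open>C\<close>.\<close>
  define B where "B = (UNIV :: nat set) <+> S"
  have "|(UNIV :: nat set)| <o |C|"
    using assms(2) by (intro countable_ordLess_uncountable) auto
  then have "|B| <o |C|"
    unfolding B_def using assms(3) inf by (intro card_of_Plus_ordLess_infinite)
  moreover have "|span S| \<le>o |B|"
  proof (rule card_of_span_ordLeq)
    show "infinite B"
      by (simp add: B_def)
    show "|S| \<le>o |B|"
      unfolding B_def by (rule card_of_Plus2)
  qed (rule assms(1))
  ultimately show ?thesis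
    using ordLeq_ordLess_trans by blast
qed

section \<open>Independence along a linear order\<close>

lemma span_finite_subset:
  assumes "x \<in> span A"
  shows "\<exists>S. finite S \<and> S \<subseteq> A \<and> x \<in> span S"
  using assms
proof (induction rule: span_induct_alt)
  case base
  show ?case by (intro exI[of _ "{}"]) auto
next
  case (step c a y)
  then obtain S where S: "finite S" "S \<subseteq> A" "y \<in> span S" by blast
  have "c *s a + y \<in> span (insert a S)"
    using S(3) span_mono[of S "insert a S"] by (intro span_add span_scale) (auto intro: span_base)
  then show ?case
    using S step(1) by (intro exI[of _ "insert a S"]) auto
qed

lemma span_transfinite_Int_finite:
  fixes z :: "'i \<Rightarrow> 'b"
  assumes lin: "linear_order r" and z: "\<And>a. z a \<notin> span (D \<union> z ` underS r a)"
    and "finite T" "x \<in> span (z ` (T \<inter> I))" "x \<in> span (D \<union> z ` (T - I))"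
  shows "x = 0"
  using assms(3-)
proof (induction "card T" arbitrary: T)
  case 0
  then show ?case by simp
next
  case (Suc n)
  have "\<exists>m\<in>T. \<forall>b\<in>T. (b, m) \<in> r"
  proof -
    have "T \<noteq> {}" using Suc.hyps(2) by auto
    with Suc.prems(1) show ?thesis
    proof (induction rule: finite_ne_induct)
      case (singleton a)
      then show ?case
        using lin by (auto simp: linear_order_on_def partial_order_on_def preorder_on_def refl_on_def)
    next
      case (insert a T)
      then obtain m where m: "m \<in> T" "\<And>b. b \<in> T \<Longrightarrow> (b, m) \<in> r" by blast
      then have "a \<noteq> m" using insert.hyps by blast
      then have "(a, a) \<in> r" and tot: "(a, m) \<in> r \<or> (m, a) \<in> r" and "trans r"
        using lin by (auto simp: linear_order_on_def partial_order_on_def preorder_on_def refl_on_def total_on_def)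
      from tot show ?case
      proof
        assume "(a, m) \<in> r"
        with m show ?thesis by blast
      next
        assume ma: "(m, a) \<in> r"
        then have "(b, a) \<in> r" if "b \<in> T" for b
          using m(2)[OF that] \<open>trans r\<close> by (meson transD)
        with \<open>(a, a) \<in> r\<close> show ?thesis by blast
      qed
    qed
  qed
  then obtain m where m: "m \<in> T" "\<And>b. b \<in> T \<Longrightarrow> (b, m) \<in> r" by blast
  define T' where "T' = T - {m}"
  have T': "n = card T'" "finite T'" "T = insert m T'"
    using Suc.hyps(2) Suc.prems(1) m(1) by (auto simp: T'_def)
  have "T' \<subseteq> underS r m"
    using m(2) by (auto simp: T'_def underS_def)
  then have mono: "span X \<subseteq> span (D \<union> z ` underS r m)" if "X \<subseteq> D \<union> z ` T'" for X
    using that by (intro span_mono) blast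
  have mono1: "span (z ` (T' \<inter> I)) \<subseteq> span (D \<union> z ` underS r m)"
    and mono2: "span (D \<union> z ` (T' - I)) \<subseteq> span (D \<union> z ` underS r m)"
    by (intro mono; blast)+
  have k0: "k = 0" if "k *s z m \<in> span (D \<union> z ` underS r m)" for k
  proof (rule ccontr)
    assume "k \<noteq> 0"
    then have "z m \<in> span (D \<union> z ` underS r m)"
      using span_scale[OF that, of "inverse k"] by simp
    with z show False by blast
  qed
  show ?case
  proof (cases "m \<in> I")
    case True
    have eq: "z ` (T \<inter> I) = insert (z m) (z ` (T' \<inter> I))" "T - I = T' - I"
      using True T'(3) by auto
    obtain k where k: "x - k *s z m \<in> span (z ` (T' \<inter> I))"
      using Suc.prems(2) unfolding eq span_breakdown_eq by blast
    have "x - (x - k *s z m) \<in> span (D \<union> z ` underS r m)"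
      by (rule span_diff[OF subsetD[OF mono2 Suc.prems(3)[unfolded eq(2)]] subsetD[OF mono1 k]])
    then have "k = 0"
      using k0 by simp
    then show ?thesis
      using Suc.hyps(1)[OF T'(1,2)] k Suc.prems(3) unfolding eq(2) by simp
  next
    case False
    have eq: "D \<union> z ` (T - I) = insert (z m) (D \<union> z ` (T' - I))" "T \<inter> I = T' \<inter> I"
      using False T'(3) by auto
    obtain k where k: "x - k *s z m \<in> span (D \<union> z ` (T' - I))"
      using Suc.prems(3) unfolding eq span_breakdown_eq by blast
    have "x - (x - k *s z m) \<in> span (D \<union> z ` underS r m)"
      by (rule span_diff[OF subsetD[OF mono1 Suc.prems(2)[unfolded eq(2)]] subsetD[OF mono2 k]])
    then have "k = 0"
      using k0 by simp
    then show ?thesis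
      using Suc.hyps(1)[OF T'(1,2)] k Suc.prems(2) unfolding eq(2) by simp
  qed
qed

text \<open>Each membership uses finitely many generators, which reduces the claim to a finite index
  set. With \<open>I\<close> the indices generating the group, it keeps \<open>D\<close> and all
  other chosen points out of the group, except for 0.\<close>

lemma span_transfinite_Int:
  fixes z :: "'i \<Rightarrow> 'b"
  assumes lin: "linear_order r" and z: "\<And>a. z a \<notin> span (D \<union> z ` underS r a)"
    and x: "x \<in> span (z ` I)" "x \<in> span (D \<union> z ` (- I))"
  shows "x = 0"
proof -
  obtain S where S: "finite S" "S \<subseteq> z ` I" "x \<in> span S"
    using span_finite_subset[OF x(1)] by blast
  then obtain T where T: "finite T" "T \<subseteq> I" "S = z ` T"
    using finite_subset_image by metis
  obtain S' where S': "finite S'" "S' \<subseteq> D \<union> z ` (- I)" "x \<in> span S'"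
    using span_finite_subset[OF x(2)] by blast
  have "finite (S' - D)" "S' - D \<subseteq> z ` (- I)"
    using S' by auto
  then obtain T' where T': "finite T'" "T' \<subseteq> - I" "S' - D = z ` T'"
    using finite_subset_image by metis
  show ?thesis
  proof (rule span_transfinite_Int_finite[OF lin z])
    show "finite (T \<union> T')"
      using T T' by simp
    show "x \<in> span (z ` ((T \<union> T') \<inter> I))"
    proof (rule subsetD[OF span_mono S(3)])
      show "S \<subseteq> z ` ((T \<union> T') \<inter> I)"
        using T(2) unfolding T(3) by blast
    qed
    show "x \<in> span (D \<union> z ` (T \<union> T' - I))"
    proof (rule subsetD[OF span_mono S'(3)])
      have "S' \<subseteq> D \<union> z ` T'" using T'(3) by blast
      then show "S' \<subseteq> D \<union> z ` (T \<union> T' - I)" using T'(2) by blast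
    qed
  qed
qed

end

section \<open>Construction of the group\<close>

lemma ex_bernstein_subgroup:
  fixes D :: "'a::euclidean_space set"
  assumes D: "countable D"
  shows "\<exists>G. additive_subgroup_set G \<and> bernstein_set G \<and> G \<inter> D \<subseteq> {0}"
proof -
  \<comment> \<open>Over the countable field of rationals, fewer than continuum many vectors span
    fewer than continuum many.\<close>
  interpret Q: vector_space "\<lambda>(q::rat) (x::'a). (of_rat q :: real) *\<^sub>R x"
  proof (rule vector_space.intro)
    fix a b :: rat and x y :: 'a
    show "(of_rat a :: real) *\<^sub>R (x + y) = (of_rat a :: real) *\<^sub>R x + (of_rat a :: real) *\<^sub>R y"
      by (rule scaleR_add_right)
    show "(of_rat (a + b) :: real) *\<^sub>R x = (of_rat a :: real) *\<^sub>R x + (of_rat b :: real) *\<^sub>R x"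
      by (simp only: of_rat_add scaleR_add_left)
    show "(of_rat a :: real) *\<^sub>R (of_rat b :: real) *\<^sub>R x = (of_rat (a * b) :: real) *\<^sub>R x"
      by (simp only: of_rat_mult scaleR_scaleR)
    show "(of_rat 1 :: real) *\<^sub>R x = x"
      by simp
  qed
  obtain \<B> :: "'a set set" where \<B>: "countable \<B>" "topological_basis \<B>"
    using ex_countable_basis by blast
  then have "\<B> \<noteq> {}"
    by (metis UNIV_I empty_iff open_UNIV topological_basisE)
  define b where "b = from_nat_into \<B>"
  have rb: "range b = \<B>"
    unfolding b_def by (rule range_from_nat_into[OF \<open>\<B> \<noteq> {}\<close> \<B>(1)])
  \<comment> \<open>The index \<open>N\<close> codes a closed set by its positive elements and, by whether it contains \<open>0\<close>, a bit that
    decides if the chosen point goes into \<open>G\<close> or is kept out of it.\<close>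
  define K where "K N = - (\<Union>n\<in>{n. Suc n \<in> N}. b n)" for N
  \<comment> \<open>Codes of countable closed sets are redirected to the whole space, so that every
    index asks for a point of an uncountable closed set.\<close>
  define F where "F N = (if uncountable (K N) then K N else UNIV)" for N
  have F: "closed (F N)" "uncountable (F N)" for N
  proof -
    have "open (b n)" for n
      using \<B>(2) rb by (metis rangeI topological_basis_open)
    then show "closed (F N)"
      unfolding F_def K_def by auto
    have "uncountable (UNIV :: 'a set)"
      using uncountable_cball[of 1 "0 :: 'a"] countable_subset[of _ UNIV] by auto
    then show "uncountable (F N)"
      by (simp add: F_def)
  qed
  have F_ex: "\<exists>N. F N = C \<and> (0 \<in> N \<longleftrightarrow> p)" if "closed C" "uncountable C" for C p
  proof -
    obtain \<B>' where "\<B>' \<subseteq> \<B>" "\<Union>\<B>' = - C"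
      using \<B>(2) \<open>closed C\<close> unfolding topological_basis_def by (metis open_Compl)
    moreover have "\<Union>\<B>' = (\<Union>n\<in>{n. b n \<in> \<B>'}. b n)"
      using \<open>\<B>' \<subseteq> \<B>\<close> rb by blast
    ultimately have C: "C = - (\<Union>n\<in>{n. b n \<in> \<B>'}. b n)"
      by (metis double_complement)
    define N where "N = Suc ` {n. b n \<in> \<B>'} \<union> {n. n = 0 \<and> p}"
    have "{n. Suc n \<in> N} = {n. b n \<in> \<B>'}" and "0 \<in> N \<longleftrightarrow> p"
      unfolding N_def by auto
    then have "K N = C" and "0 \<in> N \<longleftrightarrow> p"
      unfolding K_def by (simp_all add: C)
    then show ?thesis
      using \<open>uncountable C\<close> by (intro exI[of _ N]) (simp add: F_def)
  qed
  \<comment> \<open>In a cardinal order every \<open>underS r N\<close> is strictly smaller than the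
    whole index set, which has the size of the continuum.\<close>
  define r where "r = |UNIV :: nat set set|"
  have r: "Card_order r" "Field r = UNIV"
    unfolding r_def by (rule card_of_Card_order, rule Field_card_of)
  then have wo: "Well_order r"
    by (simp add: card_order_on_def)
  then have lin: "linear_order r" and wf: "wf (r - Id)"
    using r(2) by (auto simp: well_order_on_def)
  \<comment> \<open>In this well-founded recursion the first goal is that the requirement on
    \<open>z N\<close> depends on earlier values only; the second compares the small span with
    \<open>F N\<close>, which has at least continuum many points.\<close>
  have "\<exists>z. \<forall>N. z N \<in> F N \<and> z N \<notin> Q.span (D \<union> z ` underS r N)"
  proof (rule dependent_wf_choice[OF wf])
    fix f g :: "nat set \<Rightarrow> 'a" and N x
    assume "\<And>M. (M, N) \<in> r - Id \<Longrightarrow> f M = g M"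
    then have "f ` underS r N = g ` underS r N"
      by (intro image_cong) (auto simp: underS_def)
    then show "(x \<in> F N \<and> x \<notin> Q.span (D \<union> f ` underS r N)) =
        (x \<in> F N \<and> x \<notin> Q.span (D \<union> g ` underS r N))"
      by simp
  next
    fix N and f :: "nat set \<Rightarrow> 'a"
    have unc: "uncountable (UNIV :: nat set set)"
      using countable_eqpoll[OF _ eqpoll_sym[OF nat_sets_eqpoll_reals]] uncountable_UNIV_real by metis
    have "|underS r N| <o r"
      using r by (intro card_of_underS) simp_all
    then have "|f ` underS r N| <o |UNIV :: nat set set|"
      unfolding r_def by (rule ordLeq_ordLess_trans[OF card_of_image])
    then have "|D \<union> f ` underS r N| <o |UNIV :: nat set set|"
      using countable_ordLess_uncountable[OF D unc] unc countable_finite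
      by (intro card_of_Un_ordLess_infinite) auto
    then have "|Q.span (D \<union> f ` underS r N)| <o |UNIV :: nat set set|"
      by (intro Q.card_of_span_ordLess unc) auto
    moreover have "|UNIV :: nat set set| \<le>o |F N|"
    proof -
      have "(UNIV :: nat set set) \<lesssim> F N"
        by (rule lepoll_trans[OF eqpoll_imp_lepoll[OF nat_sets_eqpoll_reals] lepoll_uncountable_closed[OF F]])
      then show ?thesis
        unfolding lepoll_def by (rule card_of_ordLeq[THEN iffD1])
    qed
    ultimately have "|Q.span (D \<union> f ` underS r N)| <o |F N|"
      by (rule ordLess_ordLeq_trans)
    then have "\<not> F N \<subseteq> Q.span (D \<union> f ` underS r N)"
      using card_of_mono1 not_ordLess_ordLeq by metis
    then show "\<exists>x. x \<in> F N \<and> x \<notin> Q.span (D \<union> f ` underS r N)"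
      by blast
  qed
  then obtain z where z: "\<And>N. z N \<in> F N" "\<And>N. z N \<notin> Q.span (D \<union> z ` underS r N)"
    by blast
  \<comment> \<open>The points with \<open>0 \<notin> N\<close> are kept out: together with
    \<open>D\<close> they span a subspace that meets \<open>G\<close> only in 0, and no
    \<open>z N\<close> is 0.\<close>
  define G where "G = Q.span (z ` {N. 0 \<in> N})"
  have disj: "x = 0" if "x \<in> G" "x \<in> Q.span (D \<union> z ` (- {N. 0 \<in> N}))" for x
    using Q.span_transfinite_Int[OF lin z(2) that(1)[unfolded G_def] that(2)] .
  have "additive_subgroup_set G"
    unfolding additive_subgroup_set_def G_def by (auto intro: Q.span_zero Q.span_add Q.span_neg)
  moreover have "bernstein_set G"
    unfolding bernstein_set_def
  proof (intro allI impI conjI)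
    fix C :: "'a set" assume C: "closed C \<and> uncountable C"
    then obtain N where "F N = C" "0 \<in> N"
      using F_ex[of C True] by auto
    then have "z N \<in> C \<inter> G"
      using z(1)[of N] Q.span_base[of "z N" "z ` {N. 0 \<in> N}"] unfolding G_def by simp
    then show "C \<inter> G \<noteq> {}"
      by blast
    from C obtain M where M: "F M = C" "0 \<notin> M"
      using F_ex[of C False] by auto
    have "z M \<notin> G"
    proof
      assume "z M \<in> G"
      moreover have "z M \<in> Q.span (D \<union> z ` (- {N. 0 \<in> N}))"
        using M(2) by (intro Q.span_base) auto
      ultimately have "z M = 0"
        by (rule disj)
      then show False
        using z(2)[of M] Q.span_zero by metis
    qed
    then show "C \<inter> (UNIV - G) \<noteq> {}"
      using z(1)[of M] M(1) by blast
  qed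
  moreover have "G \<inter> D \<subseteq> {0}"
  proof
    fix x assume "x \<in> G \<inter> D"
    then show "x \<in> {0}"
      using disj[of x] Q.span_base[of x "D \<union> z ` (- {N. 0 \<in> N})"] by simp
  qed
  ultimately show ?thesis by blast
qed

section \<open>Disjoint dense sets of reals and the countable set to avoid\<close>

text \<open>Distinct integer multiples of an irrational \<open>c\<close> lie in distinct cosets of
  the rationals; \<open>Suc k\<close> instead of \<open>k\<close> leaves out the coset of 0.\<close>

lemma ex_disjoint_dense_grids:
  "\<exists>A :: nat \<Rightarrow> real set. (\<forall>k. countable (A k)) \<and> disjoint_family A \<and> (\<forall>k. 0 \<notin> A k) \<and>
      (\<forall>k a b. a < b \<longrightarrow> (\<exists>c\<in>A k. a < c \<and> c < b))"
proof -
  obtain c :: real where c: "c \<notin> \<rat>"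
    using countable_rat uncountable_UNIV_real by (metis UNIV_eq_I)
  define A where "A k = (\<lambda>q. real (Suc k) * c + q) ` \<rat>" for k
  have rat: "m = 0" if "real_of_int m * c \<in> \<rat>" for m
  proof (rule ccontr)
    assume "m \<noteq> 0"
    then have "c = (real_of_int m * c) / real_of_int m"
      by simp
    also have "\<dots> \<in> \<rat>"
      using that by (intro Rats_divide) auto
    finally show False
      using c by simp
  qed
  have "k = l" if kl: "x \<in> A k" "x \<in> A l" for x k l
  proof -
    obtain p q where "p \<in> \<rat>" "q \<in> \<rat>" "x = real (Suc k) * c + p" "x = real (Suc l) * c + q"
      using kl unfolding A_def by (elim imageE)
    then have "q - p \<in> \<rat>" "real_of_int (int k - int l) * c = q - p"
      by (simp_all add: algebra_simps)
    then have "int k - int l = 0"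
      using rat by metis
    then show ?thesis
      by simp
  qed
  then have "disjoint_family A"
    unfolding disjoint_family_on_def by (meson disjoint_iff)
  moreover have "countable (A k)" for k
    unfolding A_def using countable_rat by (rule countable_image)
  moreover have "0 \<notin> A k" for k
  proof
    assume "0 \<in> A k"
    then obtain q where q: "q \<in> \<rat>" "0 = real (Suc k) * c + q"
      unfolding A_def by auto
    then have "real_of_int (int (Suc k)) * c = - q"
      by simp
    then show False
      using rat[of "int (Suc k)"] q(1) by (metis Rats_minus_iff of_nat_eq_0_iff nat.distinct(1))
  qed
  moreover have "\<exists>x\<in>A k. a < x \<and> x < b" if ab: "a < b" for k a b
  proof -
    have "a - real (Suc k) * c < b - real (Suc k) * c"
      using ab by simp
    then obtain q where "q \<in> \<rat>" "a - real (Suc k) * c < q" "q < b - real (Suc k) * c"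
      using Rats_dense_in_real by blast
    then show ?thesis
      by (intro bexI[of _ "real (Suc k) * c + q"]) (auto simp: A_def)
  qed
  ultimately show ?thesis by blast
qed

text \<open>Since the \<open>A k\<close> are disjoint, the \<open>CARD('n)\<close> coordinates
  chosen for them are distinct and thus exhaust all coordinates; so every coordinate lies in the
  countable union of the \<open>A k\<close>.\<close>

lemma countable_Int_grids:
  fixes A :: "nat \<Rightarrow> real set"
  assumes A: "\<And>k. countable (A k)" "disjoint_family A"
  shows "countable {x :: real ^ 'n. \<forall>k<CARD('n). \<exists>i. x $ i \<in> A k}"
proof (rule countable_subset)
  let ?P = "PiE (UNIV :: 'n set) (\<lambda>_. \<Union>k. A k)"
  show "countable (vec_lambda ` ?P)"
    using A(1) by (intro countable_image countable_PiE) auto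
  show "{x :: real ^ 'n. \<forall>k<CARD('n). \<exists>i. x $ i \<in> A k} \<subseteq> vec_lambda ` ?P"
  proof
    fix x :: "real ^ 'n" assume "x \<in> {x. \<forall>k<CARD('n). \<exists>i. x $ i \<in> A k}"
    then have "\<forall>k. \<exists>i. k < CARD('n) \<longrightarrow> x $ i \<in> A k"
      by auto
    then obtain j where j: "\<And>k. k < CARD('n) \<Longrightarrow> x $ j k \<in> A k"
      by metis
    have "inj_on j {..<CARD('n)}"
    proof (rule inj_onI)
      fix k l assume kl: "k \<in> {..<CARD('n)}" "l \<in> {..<CARD('n)}" "j k = j l"
      then have "x $ j k \<in> A k \<inter> A l"
        using j[of k] j[of l] by auto
      then show "k = l"
        using A(2) unfolding disjoint_family_on_def by (metis UNIV_I empty_iff)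
    qed
    then have "card (j ` {..<CARD('n)}) = CARD('n)"
      by (simp add: card_image)
    then have "j ` {..<CARD('n)} = UNIV"
      by (intro card_subset_eq) auto
    then have "x $ i \<in> (\<Union>k. A k)" for i
      using j by (metis UNIV_I UN_I imageE lessThan_iff)
    then show "x \<in> vec_lambda ` ?P"
      by (intro image_eqI[of _ _ "\<lambda>i. x $ i"]) (auto simp: vec_lambda_eta)
  qed
qed

theorem theorem1:
  assumes "CARD('n::finite) \<ge> 2"
  shows "\<exists>G :: (real ^ 'n) set.
           additive_subgroup_set G \<and> closure G = UNIV \<and>
           bernstein_set G \<and>
           locally connected G \<and>
           covering_dim (top_of_set G) = ereal (real CARD('n) - 1) \<and>
           G \<notin> sets borel \<and>
           \<not> locally compact G"
proof -
  obtain A :: "nat \<Rightarrow> real set" where A: "\<forall>k. countable (A k)" "disjoint_family A" "\<forall>k. 0 \<notin> A k"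
    and dense: "\<forall>k a b. a < b \<longrightarrow> (\<exists>c\<in>A k. a < c \<and> c < b)"
    using ex_disjoint_dense_grids by blast
  define D where "D = {x :: real ^ 'n. \<forall>k<CARD('n). \<exists>i. x $ i \<in> A k}"
  have "countable D"
    unfolding D_def using A(1,2) by (intro countable_Int_grids) auto
  then obtain G :: "(real ^ 'n) set" where G: "additive_subgroup_set G" "bernstein_set G" "G \<inter> D \<subseteq> {0}"
    using ex_bernstein_subgroup by blast
  \<comment> \<open>The group contains 0, so 0 has to lie outside \<open>D\<close> for
    \<open>G\<close> to avoid \<open>D\<close> entirely.\<close>
  have "0 \<notin> D"
    using A(3) assms by (auto simp: D_def intro!: exI[of _ 0])
  then have avoid: "\<exists>k<CARD('n). \<forall>i. x $ i \<notin> A k" if "x \<in> G" for x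
    using that G(3) unfolding D_def by blast
  have "covering_dim_le (top_of_set G) (int CARD('n) - 1)"
    using dense avoid by (intro covering_dim_le_avoiding_grids) auto
  then have "covering_dim (top_of_set G) = ereal (of_int (int CARD('n) - 1))"
    unfolding covering_dim_def using covering_dim_le_bernstein[OF G(2) assms]
    by (intro antisym Inf_lower Inf_greatest) force+
  moreover have "DIM(real ^ 'n) \<ge> 2"
    using assms by simp
  ultimately show ?thesis
    using G closure_bernstein[OF G(2)] locally_connected_bernstein[OF G(2)] bernstein_not_borel[OF G(2)]
      locally_compact_imp_borel[of G] by (intro exI[of _ G]) auto
qed

end
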